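(* Assume that $a>2\sigma$ and set $C_1:=2\Phi(2\sqrt c)-1>0$, where $\Phi$ is the standard normal cumulative distribution function. Let $\hat\eta^+$ be the selector with components $\hat\eta^+_j=I\bigl(\frac1n\sum_{i=1}^nZ^i_j\ge\tau\bigr)$, $j=1,\dots,d$. If $\tau$ is chosen such that $C_1-\tau>0$, then for all $\theta\in\Theta_d^+(s,a)$, $$\mathbb{E}\Bigl[\tfrac1s|\hat\eta^+-\eta|\Bigr]\le\frac{d-|S|}{s}\exp\Bigl(-\frac{n\tau^2}{2B^2}\Bigr)+\frac{|S|}{s}\exp\Bigl(-\frac{n(C_1-\tau)^2}{2B^2}\Bigr),$$ where $S$ denotes the support of $\theta$. In particular, choosing $\tau=C_1/2$ yields $$\sup_{\theta\in\Theta_d^+(s,a)}\mathbb{E}\Bigl[\tfrac1s|\hat\eta^+-\eta|\Bigr]\le\frac ds\exp\Bigl(-\frac{C_1^2n(e^\alpha-1)^2}{8(e^\alpha+1)^2K_d^2}\Bigr)$$ for all $a\ge2\sigma$.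
   Context: Model: $\sigma>0$, $\alpha>0$, $n\ge1$, $1\le s\le d$, $\theta\in\mathbb{R}^d$; $X^1,\dots,X^n$ are i.i.d. random vectors in $\mathbb{R}^d$, $X^i=\theta+\sigma\xi^i$, where $\xi^i$ has i.i.d. coordinates whose common law on $\mathbb{R}$ is symmetric around $0$, has variance $1$ and is $c$-strongly log-concave for a constant $c>0$: it has density $p(x)=\exp(-\phi_0(x))\exp(-cx^2/2)$ with $\phi_0:\mathbb{R}\to\mathbb{R}$ a finite even convex function. $\Theta_d^+(s,a)$ is the set of $\theta\in\mathbb{R}^d$ for which there is $S\subseteq\{1,\dots,d\}$ with at most $s$ elements such that $\theta_j\ge a$ for $j\in S$ and $\theta_j=0$ for $j\notin S$. Put $\eta=(I(\theta_j\ne0))_{j=1,\dots,d}$, with $I(\cdot)$ the indicator function, and $|\hat\eta-\eta|=\sum_{j=1}^d I(\hat\eta_j\neq\eta_j)$ (Hamming loss). Privatized data (coordinate global mechanism). Let $\mathrm{sgn}[x]=1$ for $x\ge0$, $-1$ for $x<0$, and $\tilde X^i=(\mathrm{sgn}[X^i_j])_{j=1,\dots,d}$. Let $$B=\frac{e^\alpha+1}{e^\alpha-1}K_d,\qquad \frac1{K_d}=\begin{cases}\frac1{2^{d-1}}\binom{d-1}{\frac{d-1}2}& d\text{ odd},\\[2pt] \frac{(d-2)!\,(d-2)}{2^{d-1}(\frac d2-1)!\,\frac d2!}& d\text{ even}.\end{cases}$$ Independently for each $i$: draw $Y^i\sim\mathrm{Bernoulli}(\pi_\alpha)$, $\pi_\alpha=e^\alpha/(e^\alpha+1)$,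 independent of $X^i$. If $Y^i=1$, draw $\tilde Z^i$ uniformly on $\{\tilde z\in\{-B,B\}^d:\langle\tilde z,\tilde X^i\rangle>0\text{ or }(\langle\tilde z,\tilde X^i\rangle=0\text{ and }\tilde z_1=B\tilde X^i_1)\}$; if $Y^i=0$, draw $\tilde Z^i$ uniformly on $\{\tilde z\in\{-B,B\}^d:\langle\tilde z,\tilde X^i\rangle<0\text{ or }(\langle\tilde z,\tilde X^i\rangle=0\text{ and }\tilde z_1=-B\tilde X^i_1)\}$. If $d$ is odd, $Z^i=\tilde Z^i$; if $d$ is even, $Z^i_1=\frac{d-2}{2(d-1)}\tilde Z^i_1$ and $Z^i_j=\tilde Z^i_j$ for $2\le j\le d$.
   Formalization: The threshold is taken with τ ≥ 0: for τ < −B and θ = 0 every component is selected and the stated bound fails. For d = 2, where 1/K_d = 0, B and K_d are read as 0 with zero exponents, so the bounds are trivial there. *)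

theory Defs
  imports "HOL-Probability.Probability"
begin

text \<open>
  A vector of \<open>\<real>\<^sup>d\<close> is a function on the index set \<open>{1..d}\<close>, extended by \<^const>\<open>undefined\<close>;
  users are indexed by \<open>{1..n}\<close>.
\<close>


section \<open>Sparse vectors, supports and the Hamming loss\<close>

definition sparse_nonneg :: "nat \<Rightarrow> nat \<Rightarrow> real \<Rightarrow> (nat \<Rightarrow> real) set" where
  "sparse_nonneg d s a =
     {\<theta> \<in> {1..d} \<rightarrow>\<^sub>E UNIV. \<exists>S \<subseteq> {1..d}. card S \<le> s \<and> (\<forall>j\<in>S. \<theta> j \<ge> a) \<and> (\<forall>j\<in>{1..d} - S. \<theta> j = 0)}"

definition supp :: "nat \<Rightarrow> (nat \<Rightarrow> real) \<Rightarrow> nat set" where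
  "supp d \<theta> = {j \<in> {1..d}. \<theta> j \<noteq> 0}"

definition pattern :: "(nat \<Rightarrow> real) \<Rightarrow> nat \<Rightarrow> nat" where
  "pattern \<theta> j = of_bool (\<theta> j \<noteq> 0)"

definition hamming :: "nat \<Rightarrow> (nat \<Rightarrow> nat) \<Rightarrow> (nat \<Rightarrow> nat) \<Rightarrow> real" where
  "hamming d \<eta>' \<eta> = (\<Sum>j = 1..d. of_bool (\<eta>' j \<noteq> \<eta> j))"


section \<open>The noise and the data\<close>

definition strongly_log_concave :: "real \<Rightarrow> real measure \<Rightarrow> bool" where
  "strongly_log_concave c \<nu> \<longleftrightarrow>
     (\<exists>\<phi>\<^sub>0 :: real \<Rightarrow> real. convex_on UNIV \<phi>\<^sub>0 \<and> (\<forall>x. \<phi>\<^sub>0 (- x) = \<phi>\<^sub>0 x) \<and>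
        \<nu> = density lborel (\<lambda>x. ennreal (exp (- \<phi>\<^sub>0 x) * exp (- (c * x\<^sup>2 / 2)))))"

text \<open>The law of one observation \<open>\<theta> + \<sigma> \<xi>\<close>, where the coordinates of \<open>\<xi>\<close> are i.i.d. with law \<open>\<nu>\<close>.\<close>

definition data_law :: "nat \<Rightarrow> real \<Rightarrow> real measure \<Rightarrow> (nat \<Rightarrow> real) \<Rightarrow> (nat \<Rightarrow> real) measure" where
  "data_law d \<sigma> \<nu> \<theta> =
     distr (\<Pi>\<^sub>M j\<in>{1..d}. \<nu>) (\<Pi>\<^sub>M j\<in>{1..d}. borel) (\<lambda>\<xi>. \<lambda>j\<in>{1..d}. \<theta> j + \<sigma> * \<xi> j)"


section \<open>The coordinate global privacy mechanism\<close>

text \<open>Unlike \<^const>\<open>sgn\<close>, this sign is \<open>1\<close> at \<open>0\<close>.\<close>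

definition sgn1 :: "real \<Rightarrow> real" where
  "sgn1 x = (if x \<ge> 0 then 1 else - 1)"

definition sgn_vec :: "nat \<Rightarrow> (nat \<Rightarrow> real) \<Rightarrow> nat \<Rightarrow> real" where
  "sgn_vec d x = (\<lambda>j\<in>{1..d}. sgn1 (x j))"

text \<open>
  For \<open>d = 2\<close> the formula for \<open>1 / K\<^sub>d\<close> gives \<open>0\<close>, so that \<open>K\<^sub>d\<close> is infinite there; with
  \<open>1 / 0 = 0\<close> both \<open>K_const 2\<close> and \<open>B_const \<alpha> 2\<close> are \<open>0\<close>. Quotients with denominator
  \<open>B\<^sup>2\<close> or \<open>K\<^sub>d\<^sup>2\<close> then are \<open>0\<close>, which is also their value for \<open>K\<^sub>d = \<infinity>\<close>.
\<close>

definition K_const :: "nat \<Rightarrow> real" where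
  "K_const d = 1 /
     (if odd d then 1 / 2 ^ (d - 1) * real ((d - 1) choose ((d - 1) div 2))
      else fact (d - 2) * real (d - 2) / (2 ^ (d - 1) * fact (d div 2 - 1) * fact (d div 2)))"

definition B_const :: "real \<Rightarrow> nat \<Rightarrow> real" where
  "B_const \<alpha> d = (exp \<alpha> + 1) / (exp \<alpha> - 1) * K_const d"

definition agreeing :: "nat \<Rightarrow> real \<Rightarrow> (nat \<Rightarrow> real) \<Rightarrow> (nat \<Rightarrow> real) set" where
  "agreeing d B x =
     {z \<in> {1..d} \<rightarrow>\<^sub>E {- B, B}.
        (\<Sum>j = 1..d. z j * x j) > 0 \<or> (\<Sum>j = 1..d. z j * x j) = 0 \<and> z 1 = B * x 1}"

definition opposing :: "nat \<Rightarrow> real \<Rightarrow> (nat \<Rightarrow> real) \<Rightarrow> (nat \<Rightarrow> real) set" where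
  "opposing d B x =
     {z \<in> {1..d} \<rightarrow>\<^sub>E {- B, B}.
        (\<Sum>j = 1..d. z j * x j) < 0 \<or> (\<Sum>j = 1..d. z j * x j) = 0 \<and> z 1 = - B * x 1}"

definition rescale_first :: "nat \<Rightarrow> (nat \<Rightarrow> real) \<Rightarrow> nat \<Rightarrow> real" where
  "rescale_first d z =
     (if odd d then z else z(1 := (real d - 2) / (2 * (real d - 1)) * z 1))"

text \<open>The conditional law of the privatized vector of a user, given his data vector \<open>x\<close>.\<close>

definition privatize :: "real \<Rightarrow> nat \<Rightarrow> (nat \<Rightarrow> real) \<Rightarrow> (nat \<Rightarrow> real) pmf" where
  "privatize \<alpha> d x =
     bind_pmf (bernoulli_pmf (exp \<alpha> / (exp \<alpha> + 1))) (\<lambda>y.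
       map_pmf (rescale_first d)
         (pmf_of_set (if y then agreeing d (B_const \<alpha> d) (sgn_vec d x)
                           else opposing d (B_const \<alpha> d) (sgn_vec d x))))"

definition private_law :: "real \<Rightarrow> nat \<Rightarrow> real \<Rightarrow> real measure \<Rightarrow> (nat \<Rightarrow> real) \<Rightarrow> (nat \<Rightarrow> real) measure" where
  "private_law \<alpha> d \<sigma> \<nu> \<theta> =
     Giry_Monad.bind (data_law d \<sigma> \<nu> \<theta>) (\<lambda>x. measure_pmf (privatize \<alpha> d x))"

text \<open>The joint law of \<open>Z\<^sup>1, \<dots>, Z\<^sup>n\<close>.\<close>

definition private_sample ::
  "real \<Rightarrow> nat \<Rightarrow> nat \<Rightarrow> real \<Rightarrow> real measure \<Rightarrow> (nat \<Rightarrow> real) \<Rightarrow> (nat \<Rightarrow> nat \<Rightarrow> real) measure" where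
  "private_sample \<alpha> d n \<sigma> \<nu> \<theta> = (\<Pi>\<^sub>M i\<in>{1..n}. private_law \<alpha> d \<sigma> \<nu> \<theta>)"

definition selector :: "nat \<Rightarrow> real \<Rightarrow> (nat \<Rightarrow> nat \<Rightarrow> real) \<Rightarrow> nat \<Rightarrow> nat" where
  "selector n \<tau> Z j = of_bool (1 / real n * (\<Sum>i = 1..n. Z i j) \<ge> \<tau>)"


section \<open>Well-definedness\<close>

lemma finite_agreeing: "finite (agreeing d B x)"
  unfolding agreeing_def
  by (rule finite_subset[of _ "{1..d} \<rightarrow>\<^sub>E {- B, B}"]) (auto intro: finite_PiE)

lemma finite_opposing: "finite (opposing d B x)"
  unfolding opposing_def
  by (rule finite_subset[of _ "{1..d} \<rightarrow>\<^sub>E {- B, B}"]) (auto intro: finite_PiE)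

lemma agreeing_opposing_nonempty:
  assumes "0 \<le> B" "1 \<le> d"
  shows "agreeing d B (sgn_vec d x) \<noteq> {}" and "opposing d B (sgn_vec d x) \<noteq> {}"
proof -
  let ?v = "sgn_vec d x"
  have v: "?v j * ?v j = 1" if "j \<in> {1..d}" for j
    using that by (auto simp: sgn_vec_def sgn1_def)
  have s: "(\<Sum>j = 1..d. (b * ?v j) * ?v j) = b * real d" for b
  proof -
    have "(\<Sum>j = 1..d. (b * ?v j) * ?v j) = (\<Sum>j = 1..d. b)"
      by (intro sum.cong refl) (use v in \<open>auto simp: mult.assoc\<close>)
    then show ?thesis by simp
  qed
  have s': "(\<Sum>j = 1..d. (\<lambda>j\<in>{1..d}. b * ?v j) j * ?v j) = b * real d" for b
    unfolding s[of b, symmetric] by (intro sum.cong refl) simp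
  have m: "(\<lambda>j\<in>{1..d}. b * ?v j) \<in> {1..d} \<rightarrow>\<^sub>E {- B, B}" if "b = B \<or> b = - B" for b
    using that by (auto simp: sgn_vec_def sgn1_def)
  have "(\<lambda>j\<in>{1..d}. B * ?v j) \<in> agreeing d B ?v"
    unfolding agreeing_def using m[of B] s'[of B] assms by (cases "B = 0") auto
  then show "agreeing d B ?v \<noteq> {}" by blast
  have "(\<lambda>j\<in>{1..d}. - B * ?v j) \<in> opposing d B ?v"
    unfolding opposing_def using m[of "- B"] s'[of "- B"] assms by (cases "B = 0") auto
  then show "opposing d B ?v \<noteq> {}" by blast
qed

lemma privatize_measurable:
  "(\<lambda>x. measure_pmf (privatize \<alpha> d x))
     \<in> measurable (\<Pi>\<^sub>M j\<in>{1..d}. borel) (subprob_algebra (count_space UNIV))"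
proof -
  let ?F = "{1..d} \<rightarrow>\<^sub>E {- 1, 1 :: real}"
  let ?g = "\<lambda>v. measure_pmf (bind_pmf (bernoulli_pmf (exp \<alpha> / (exp \<alpha> + 1))) (\<lambda>y.
       map_pmf (rescale_first d)
         (pmf_of_set (if y then agreeing d (B_const \<alpha> d) v else opposing d (B_const \<alpha> d) v))))"
  have sgn1 [measurable]: "sgn1 \<in> borel_measurable borel"
    unfolding sgn1_def by measurable
  have sv: "sgn_vec d \<in> measurable (\<Pi>\<^sub>M j\<in>{1..d}. borel) (\<Pi>\<^sub>M j\<in>{1..d}. borel)"
    unfolding sgn_vec_def by measurable
  have "sgn_vec d \<in> measurable (\<Pi>\<^sub>M j\<in>{1..d}. borel) (count_space ?F)"
  proof (subst measurable_count_space_eq2)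
    show "finite ?F" by (auto intro: finite_PiE)
    have "sgn_vec d -` {v} \<inter> space (\<Pi>\<^sub>M j\<in>{1..d}. borel) \<in> sets (\<Pi>\<^sub>M j\<in>{1..d}. borel)"
      if "v \<in> ?F" for v
    proof (rule measurable_sets[OF sv])
      have "{v} = (\<Pi>\<^sub>E j\<in>{1..d}. {v j})"
        using that by (subst PiE_singleton) (auto simp: PiE_iff)
      moreover have "(\<Pi>\<^sub>E j\<in>{1..d}. {v j}) \<in> sets (\<Pi>\<^sub>M j\<in>{1..d}. (borel :: real measure))"
        by (intro sets_PiM_I_finite) auto
      ultimately show "{v} \<in> sets (\<Pi>\<^sub>M j\<in>{1..d}. (borel :: real measure))" by simp
    qed
    then show "sgn_vec d \<in> space (\<Pi>\<^sub>M j\<in>{1..d}. borel) \<rightarrow> ?F \<and>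
        (\<forall>a\<in>?F. sgn_vec d -` {a} \<inter> space (\<Pi>\<^sub>M j\<in>{1..d}. borel) \<in> sets (\<Pi>\<^sub>M j\<in>{1..d}. borel))"
      by (auto simp: sgn_vec_def sgn1_def)
  qed
  moreover have "?g \<in> measurable (count_space ?F) (subprob_algebra (count_space UNIV))"
    by (auto intro: measure_pmf_in_subprob_algebra)
  ultimately have "(\<lambda>x. ?g (sgn_vec d x))
      \<in> measurable (\<Pi>\<^sub>M j\<in>{1..d}. borel) (subprob_algebra (count_space UNIV))"
    by (rule measurable_compose)
  then show ?thesis by (simp add: privatize_def)
qed

lemma
  assumes "prob_space \<nu>" "sets \<nu> = sets borel"
  shows prob_space_private_law: "prob_space (private_law \<alpha> d \<sigma> \<nu> \<theta>)"
    and sets_private_law: "sets (private_law \<alpha> d \<sigma> \<nu> \<theta>) = UNIV"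
proof -
  interpret product: prob_space "\<Pi>\<^sub>M j\<in>{1..d}. \<nu>"
    using assms(1) by (rule prob_space_PiM)
  have proj [measurable]:
    "(\<lambda>\<xi>. \<xi> j) \<in> borel_measurable (\<Pi>\<^sub>M j\<in>{1..d}. \<nu>)" if "j \<in> {1..d}" for j
    using measurable_component_singleton[OF that, of "\<lambda>_. \<nu>"] measurable_cong_sets[OF refl assms(2)]
    by blast
  have shift: "(\<lambda>\<xi>. \<lambda>j\<in>{1..d}. \<theta> j + \<sigma> * \<xi> j)
      \<in> measurable (\<Pi>\<^sub>M j\<in>{1..d}. \<nu>) (\<Pi>\<^sub>M j\<in>{1..d}. borel)"
    by (intro measurable_restrict borel_measurable_add borel_measurable_times
        borel_measurable_const proj)
  interpret D: prob_space "data_law d \<sigma> \<nu> \<theta>"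
    unfolding data_law_def by (rule product.prob_space_distr[OF shift])
  have k: "(\<lambda>x. measure_pmf (privatize \<alpha> d x))
      \<in> measurable (data_law d \<sigma> \<nu> \<theta>) (subprob_algebra (count_space UNIV))"
    using privatize_measurable by (simp add: data_law_def)
  show "prob_space (private_law \<alpha> d \<sigma> \<nu> \<theta>)"
    unfolding private_law_def
    by (rule D.prob_space_bind[OF _ k]) (auto intro: prob_space_measure_pmf)
  show "sets (private_law \<alpha> d \<sigma> \<nu> \<theta>) = UNIV"
    unfolding private_law_def using D.not_empty by (subst sets_bind) auto
qed

lemma
  assumes "prob_space \<nu>" "sets \<nu> = sets borel"
  shows prob_space_private_sample: "prob_space (private_sample \<alpha> d n \<sigma> \<nu> \<theta>)"
    and integrable_hamming_selector:
      "integrable (private_sample \<alpha> d n \<sigma> \<nu> \<theta>) (\<lambda>Z. hamming d (selector n \<tau> Z) \<eta>)"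
proof -
  show "prob_space (private_sample \<alpha> d n \<sigma> \<nu> \<theta>)"
    unfolding private_sample_def by (intro prob_space_PiM prob_space_private_law assms)
  then interpret P: prob_space "private_sample \<alpha> d n \<sigma> \<nu> \<theta>" .
  have Z [measurable]: "(\<lambda>Z. Z i j) \<in> borel_measurable (private_sample \<alpha> d n \<sigma> \<nu> \<theta>)"
    if "i \<in> {1..n}" for i j
  proof -
    have "(\<lambda>Z. Z i) \<in> measurable (private_sample \<alpha> d n \<sigma> \<nu> \<theta>) (private_law \<alpha> d \<sigma> \<nu> \<theta>)"
      unfolding private_sample_def using that by (rule measurable_component_singleton)
    moreover have "(\<lambda>z. z j) \<in> borel_measurable (private_law \<alpha> d \<sigma> \<nu> \<theta>)"
      by (rule measurableI) (auto simp: sets_private_law[OF assms])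
    ultimately show ?thesis by (rule measurable_compose)
  qed
  have mean [measurable]: "(\<lambda>Z. 1 / real n * (\<Sum>i = 1..n. Z i j))
      \<in> borel_measurable (private_sample \<alpha> d n \<sigma> \<nu> \<theta>)" for j
    by (intro borel_measurable_times borel_measurable_const borel_measurable_sum Z)
  have "(\<lambda>Z. of_bool (selector n \<tau> Z j \<noteq> \<eta> j) :: real)
      \<in> borel_measurable (private_sample \<alpha> d n \<sigma> \<nu> \<theta>)" for j
    unfolding selector_def by measurable
  then show "integrable (private_sample \<alpha> d n \<sigma> \<nu> \<theta>) (\<lambda>Z. hamming d (selector n \<tau> Z) \<eta>)"
    unfolding hamming_def
    by (intro Bochner_Integration.integrable_sum P.integrable_const_bound[where B = 1]) auto
qed

end

theory Submission
  imports Defs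
begin

text \<open>
  The scaled signs are unbiased: averaging over the agreeing half of the cube reduces to counting the
  coordinates that are pivotal in a majority vote with ties broken by the first voter, which gives
  \<open>E Z\<^sub>j = E sgn X\<^sub>j = P (\<bar>\<xi>\<^sub>j\<bar> \<le> \<theta>\<^sub>j / \<sigma>)\<close>. This is \<open>0\<close> off the support, and on the
  support it is at least \<open>C\<^sub>1\<close>, because a strongly log-concave symmetric law is more concentrated
  on \<open>[- 2, 2]\<close> than \<open>N(0, 1/c)\<close>. As \<open>\<bar>Z\<^sub>j\<bar> \<le> B\<close>, Hoeffding's inequality bounds the error
  probability of each coordinate. For \<open>d = 2\<close>, where \<open>B_const\<close> is \<open>0\<close>, the bounds are trivial.
\<close>


section \<open>Concentration of strongly log-concave laws\<close>

text \<open>Write P and Q for the laws with densities \<open>p\<close> and \<open>q\<close>.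
  Integrating the two comparisons gives r Q(A) \<le> P(A) and, on the complement, 1 - P(A) \<le> r
  (1 - Q(A)). The first settles the case r > 1, the second the case r \<le> 1.\<close>

lemma measure_crossing_densities_le:
  fixes p q :: "'a \<Rightarrow> ennreal" and r :: real
  assumes p: "prob_space (density M p)" "p \<in> borel_measurable M"
    and q: "prob_space (density M q)" "q \<in> borel_measurable M"
    and A: "A \<in> sets M" and r: "0 \<le> r"
    and inside: "\<And>x. x \<in> A \<Longrightarrow> ennreal r * q x \<le> p x"
    and outside: "\<And>x. x \<in> space M - A \<Longrightarrow> p x \<le> ennreal r * q x"
  shows "measure (density M q) A \<le> measure (density M p) A"
proof -
  interpret P: prob_space "density M p" by fact
  interpret Q: prob_space "density M q" by fact
  note [measurable] = p(2) q(2) A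
  have "ennreal r * emeasure (density M q) A \<le> emeasure (density M p) A"
    unfolding emeasure_density[OF p(2) A] emeasure_density[OF q(2) A]
    by (subst nn_integral_cmult[symmetric])
      (auto intro!: nn_integral_mono simp: inside split: split_indicator)
  then have 1: "r * measure (density M q) A \<le> measure (density M p) A"
    using r by (simp add: P.emeasure_eq_measure Q.emeasure_eq_measure flip: ennreal_mult')
  have "emeasure (density M p) (space M - A) \<le> ennreal r * emeasure (density M q) (space M - A)"
    unfolding emeasure_density[OF p(2) sets.compl_sets[OF A]]
      emeasure_density[OF q(2) sets.compl_sets[OF A]]
    by (subst nn_integral_cmult[symmetric])
      (auto intro!: nn_integral_mono simp: outside split: split_indicator)
  then have "measure (density M p) (space M - A) \<le> r * measure (density M q) (space M - A)"
    using r by (simp add: P.emeasure_eq_measure Q.emeasure_eq_measure flip: ennreal_mult')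
  then have 2: "1 - measure (density M p) A \<le> r * (1 - measure (density M q) A)"
    using P.prob_compl[of A] Q.prob_compl[of A] A by simp
  show ?thesis
  proof (cases "r \<le> 1")
    case True
    then have "r * (1 - measure (density M q) A) \<le> 1 * (1 - measure (density M q) A)"
      by (intro mult_right_mono) auto
    with 2 show ?thesis by simp
  next
    case False
    then have "1 * measure (density M q) A \<le> r * measure (density M q) A"
      by (intro mult_right_mono) auto
    with 1 show ?thesis by simp
  qed
qed

text \<open>The point \<open>x\<close> lies on the segment from \<open>- y\<close> to
  \<open>y\<close>, and an even function has the same value at both ends.\<close>

lemma convex_on_even_mono:
  fixes f :: "real \<Rightarrow> real"
  assumes "convex_on UNIV f" "\<And>x. f (- x) = f x" "\<bar>x\<bar> \<le> \<bar>y\<bar>"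
  shows "f x \<le> f y"
proof (cases "y = 0")
  case False
  \<comment> \<open>The weight of \<open>- y\<close> when \<open>x\<close> is written as a convex
    combination of \<open>y\<close> and \<open>- y\<close>.\<close>
  define u where "u = (1 - x / y) / 2"
  have "\<bar>x / y\<bar> \<le> 1" using assms(3) False by (simp add: divide_le_eq_1)
  then have "- 1 \<le> x / y \<and> x / y \<le> 1" by linarith
  then have u: "0 \<le> u" "u \<le> 1" by (auto simp: u_def)
  have "(1 - u) *\<^sub>R y + u *\<^sub>R (- y) = x" using False by (simp add: u_def field_simps)
  then have "f x \<le> (1 - u) * f y + u * f (- y)"
    using convex_onD[OF assms(1) u, of y "- y"] by simp
  then show ?thesis by (simp add: assms(2) algebra_simps)
qed (use assms in auto)

lemma measure_std_normal_scaled: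
  assumes "\<sigma> > 0"
  shows "measure (density lborel (normal_density 0 \<sigma>)) {- t..t}
    = measure std_normal_distribution {- (t / \<sigma>)..t / \<sigma>}"
proof -
  interpret prob_space std_normal_distribution by (rule prob_space_normal_density) simp
  have "distributed std_normal_distribution lborel (\<lambda>x. x) std_normal_density"
    by (auto simp: distributed_def distr_id2)
  from normal_density_affine[OF this, of \<sigma> 0] assms
  have "distr std_normal_distribution lborel (\<lambda>x. \<sigma> * x) = density lborel (normal_density 0 \<sigma>)"
    by (simp add: distributed_def)
  then have "measure (density lborel (normal_density 0 \<sigma>)) {- t..t}
      = measure (distr std_normal_distribution lborel (\<lambda>x. \<sigma> * x)) {- t..t}" by simp
  also have "\<dots> = measure std_normal_distribution ((\<lambda>x. \<sigma> * x) -` {- t..t})"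
    by (subst measure_distr) auto
  also have "(\<lambda>x. \<sigma> * x) -` {- t..t} = {- (t / \<sigma>)..t / \<sigma>}"
    using assms by (auto simp: field_simps)
  finally show ?thesis .
qed

lemma strongly_log_concave_density:
  assumes "strongly_log_concave c \<nu>"
  obtains f :: "real \<Rightarrow> real" where "convex_on UNIV f" "\<And>x. f (- x) = f x"
    "f \<in> borel_measurable borel"
    "\<nu> = density lborel (\<lambda>x. ennreal (exp (- f x) * exp (- (c * x\<^sup>2 / 2))))"
proof -
  from assms obtain f :: "real \<Rightarrow> real" where f: "convex_on UNIV f" "\<And>x. f (- x) = f x"
    "\<nu> = density lborel (\<lambda>x. ennreal (exp (- f x) * exp (- (c * x\<^sup>2 / 2))))"
    unfolding strongly_log_concave_def by blast
  moreover have "f \<in> borel_measurable borel"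
    by (intro borel_measurable_continuous_onI convex_on_continuous f(1)) simp
  ultimately show thesis using that by blast
qed

text \<open>Off the support, the mean of a privatized coordinate is the noise mass of the degenerate
  interval \<open>{0}\<close>; this is what makes it vanish.\<close>

lemma strongly_log_concave_atomless:
  assumes "strongly_log_concave c \<nu>"
  shows "measure \<nu> {x} = 0"
proof -
  obtain f :: "real \<Rightarrow> real" where [measurable]: "f \<in> borel_measurable borel"
    and \<nu>: "\<nu> = density lborel (\<lambda>x. ennreal (exp (- f x) * exp (- (c * x\<^sup>2 / 2))))"
    using strongly_log_concave_density[OF assms] by blast
  have "{x} \<in> null_sets \<nu>"
    unfolding \<nu> by (subst null_sets_density_iff) (auto intro!: AE_I'[of "{x}"])
  then show ?thesis by (rule measure_eq_0_null_sets)
qed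

text \<open>
  The density of \<open>\<nu>\<close> relative to \<open>N(0, 1/c)\<close> is proportional to \<open>exp (- \<phi>\<^sub>0)\<close>, which decreases
  in \<open>\<bar>x\<bar>\<close>; hence the two densities cross at \<open>\<bar>x\<bar> = t\<close> after rescaling one of them.
\<close>
lemma strongly_log_concave_concentration:
  assumes "strongly_log_concave c \<nu>" "prob_space \<nu>" "c > 0"
  shows "measure std_normal_distribution {- (t * sqrt c)..t * sqrt c} \<le> measure \<nu> {- t..t}"
proof (cases "t \<ge> 0")
  case True
  obtain f :: "real \<Rightarrow> real" where f: "convex_on UNIV f" "\<And>x. f (- x) = f x"
    and [measurable]: "f \<in> borel_measurable borel"
    and \<nu>: "\<nu> = density lborel (\<lambda>x. ennreal (exp (- f x) * exp (- (c * x\<^sup>2 / 2))))"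
    using strongly_log_concave_density[OF assms(1)] by blast
  define \<rho> where "\<rho> = 1 / sqrt c"
  have \<rho>: "\<rho> > 0" using assms(3) by (simp add: \<rho>_def)
  define k where "k = sqrt (2 * pi * \<rho>\<^sup>2)"
  have k: "k > 0" using \<rho> by (simp add: k_def)
  have nd: "normal_density 0 \<rho> x = exp (- (c * x\<^sup>2 / 2)) / k" for x
    using assms(3) by (simp add: normal_density_def k_def \<rho>_def power_divide field_simps)
  have "measure (density lborel (normal_density 0 \<rho>)) {- t..t} \<le> measure \<nu> {- t..t}"
    unfolding \<nu>
  \<comment> \<open>The quotient of the density of \<open>\<nu>\<close> by that of N(0, 1/c) is
    \<open>k * exp (- f x)\<close>: the Gaussian weights cancel and the normalizing constant
    \<open>k\<close> remains. Its value at \<open>x = t\<close> is the crossing level.\<close>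
  proof (rule measure_crossing_densities_le[where r = "k * exp (- f t)"])
    show "prob_space (density lborel (normal_density 0 \<rho>))"
      using \<rho> by (rule prob_space_normal_density)
    fix x
    have eq: "ennreal (k * exp (- f t)) * ennreal (normal_density 0 \<rho> x)
        = ennreal (exp (- f t) * exp (- (c * x\<^sup>2 / 2)))"
      using k by (simp add: nd flip: ennreal_mult')
    show "ennreal (k * exp (- f t)) * ennreal (normal_density 0 \<rho> x)
        \<le> ennreal (exp (- f x) * exp (- (c * x\<^sup>2 / 2)))" if "x \<in> {- t..t}"
      unfolding eq using that by (auto intro!: ennreal_leI convex_on_even_mono[OF f])
    show "ennreal (exp (- f x) * exp (- (c * x\<^sup>2 / 2)))
        \<le> ennreal (k * exp (- f t)) * ennreal (normal_density 0 \<rho> x)"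
      if "x \<in> space lborel - {- t..t}"
      unfolding eq using that True by (auto intro!: ennreal_leI convex_on_even_mono[OF f])
  qed (use assms(2) k in \<open>auto simp: \<nu>\<close>)
  then show ?thesis
    using measure_std_normal_scaled[OF \<rho>, of t] by (simp add: \<rho>_def)
next
  case False
  then have "{- (t * sqrt c)..t * sqrt c} = {}"
    using assms(3) mult_neg_pos[of t "sqrt c"] by auto
  then show ?thesis by simp
qed

section \<open>Symmetric laws and the constant C1\<close>

text \<open>Cutting \<open>{- t..}\<close> at \<open>t\<close> leaves \<open>{t<..}\<close>, whose
  complement \<open>{..t}\<close> is the mirror image of \<open>{- t..}\<close>. This serves twice:
  for the noise it turns the mean of a sign into the mass of an interval, and for the normal law it
  does the same to C1.\<close>

lemma measure_symmetric_interval: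
  fixes N :: "real measure"
  assumes "prob_space N" "sets N = sets borel" "distr N borel uminus = N" "t \<ge> 0"
  shows "measure N {- t..t} = 2 * measure N {- t..} - 1"
    and "measure N {..t} = measure N {- t..}"
proof -
  interpret prob_space N by fact
  note [simp] = assms(2) sets_eq_imp_space_eq[OF assms(2)]
  have uminus: "uminus \<in> measurable N borel"
    by (subst measurable_cong_sets[OF assms(2) refl]) simp
  have refl: "measure N A = measure N (uminus -` A)" if "A \<in> sets borel" for A
    using measure_distr[OF uminus that] unfolding assms(3) by simp
  have "uminus -` {..t} = {- t..}" by auto
  with refl[of "{..t}"] show eq: "measure N {..t} = measure N {- t..}" by simp
  have "measure N ({- t..t} \<union> {t<..}) = measure N {- t..t} + measure N {t<..}"
    by (intro finite_measure_Union) auto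
  also have "{- t..t} \<union> {t<..} = {- t..}" using assms(4) by auto
  also have "{t<..} = space N - {..t}" by auto
  also have "measure N \<dots> = 1 - measure N {..t}" by (rule prob_compl) simp
  finally show "measure N {- t..t} = 2 * measure N {- t..} - 1" by (simp add: eq)
qed

lemma distr_std_normal_uminus: "distr std_normal_distribution borel uminus = std_normal_distribution"
proof -
  interpret prob_space std_normal_distribution by (rule prob_space_normal_density) simp
  have "distributed std_normal_distribution lborel (\<lambda>x. x) std_normal_density"
    by (auto simp: distributed_def distr_id2)
  from normal_density_affine[OF this, of "- 1" 0]
  have "distr std_normal_distribution lborel uminus = std_normal_distribution"
    by (simp add: distributed_def)
  then show ?thesis by (simp cong: distr_cong)
qed

lemma cdf_std_normal_symmetric:
  assumes "t \<ge> 0"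
  shows "2 * cdf std_normal_distribution t - 1 = measure std_normal_distribution {- t..t}"
  using measure_symmetric_interval[OF _ _ distr_std_normal_uminus assms]
    prob_space_normal_density[of 1 0]
  by (simp add: cdf_def)

lemma measure_std_normal_interval_pos:
  assumes "t > 0"
  shows "measure std_normal_distribution {- t..t} > 0"
proof -
  interpret prob_space std_normal_distribution by (rule prob_space_normal_density) simp
  have "emeasure std_normal_distribution {- t..t} \<noteq> 0"
  proof
    assume "emeasure std_normal_distribution {- t..t} = 0"
    then have "AE x in lborel. ennreal (std_normal_density x) * indicator {- t..t} x = 0"
      by (simp add: emeasure_density nn_integral_0_iff_AE)
    then have "AE x in lborel. x \<notin> {- t..t}"
      by eventually_elim
        (use normal_density_pos[of 1 0] in \<open>auto simp: ennreal_eq_0_iff not_le[symmetric]\<close>)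
    then have "emeasure lborel {- t..t} = 0"
      by (subst (asm) AE_iff_measurable[of "{- t..t}"]) auto
    with assms show False by simp
  qed
  then show ?thesis by (simp add: emeasure_eq_measure zero_less_measure_iff)
qed


section \<open>Unbiasedness of the mechanism\<close>

text \<open>The sum is the number of members of \<open>F\<close> containing \<open>j\<close> minus
  the number of those avoiding it. By monotonicity, each member A avoiding \<open>j\<close> is
  cancelled by \<open>insert j A\<close>. What is left are the sets that enter \<open>F\<close> only
  when \<open>j\<close> joins, that is, those for which voter \<open>j\<close> is pivotal.\<close>

lemma sum_signs_pivotal:
  assumes "finite U" "j \<in> U" "F \<subseteq> Pow U"
    and up: "\<And>A. A \<in> F \<Longrightarrow> insert j A \<in> F"
  shows "(\<Sum>A\<in>F. if j \<in> A then 1 else - 1 :: real)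
    = real (card {A. A \<subseteq> U - {j} \<and> A \<notin> F \<and> insert j A \<in> F})"
proof -
  let ?G = "{A. A \<subseteq> U - {j} \<and> insert j A \<in> F}" and ?F0 = "{A \<in> F. j \<notin> A}"
  have fin: "finite F" "finite ?G"
    using assms(1,3) by (auto intro: finite_subset[of _ "Pow U"])
  have "{A \<in> F. j \<in> A} = insert j ` ?G"
  proof (intro equalityI subsetI)
    fix A assume "A \<in> {A \<in> F. j \<in> A}"
    then have "A = insert j (A - {j})" "A - {j} \<in> ?G"
      using assms(3) by (auto simp: insert_absorb)
    then show "A \<in> insert j ` ?G" by (rule image_eqI)
  qed auto
  moreover have "inj_on (insert j) ?G" by (auto simp: inj_on_def)
  ultimately have "card {A \<in> F. j \<in> A} = card ?G" by (simp add: card_image)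
  moreover have "?F0 \<subseteq> ?G" using assms(3) up by auto
  moreover have "?G - ?F0 = {A. A \<subseteq> U - {j} \<and> A \<notin> F \<and> insert j A \<in> F}" by auto
  moreover have "(\<Sum>A\<in>F. if j \<in> A then 1 else - 1 :: real)
      = real (card {A \<in> F. j \<in> A}) - real (card ?F0)"
    using fin(1) by (simp add: sum.If_cases Int_def Compl_eq)
  ultimately show ?thesis
    using card_Diff_subset[of ?F0 ?G] card_mono[OF fin(2), of ?F0] fin(1)
    by (simp add: of_nat_diff)
qed

text \<open>A set A stands for the coordinates in which a point of the cube agrees with the sign
  vector. The inner product is positive iff A is more than half of \<open>{1..d}\<close>, and at a
  tie the first coordinate decides.\<close>

definition majority :: "nat \<Rightarrow> nat set set" where
  "majority d = {A. A \<subseteq> {1..d} \<and> (d < 2 * card A \<or> d = 2 * card A \<and> 1 \<in> A)}"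

text \<open>Of a set and its complement exactly one wins: sizes decide unless they are equal, and
  then the one containing voter 1 wins. So the family is half of the power set.\<close>

lemma card_majority:
  assumes "d \<ge> 1"
  shows "card (majority d) = 2 ^ (d - 1)"
proof -
  have card_compl: "card ({1..d} - A) = d - card A \<and> card A \<le> d" if "A \<subseteq> {1..d}" for A
    using that card_mono[OF _ that] by (simp add: card_Diff_subset finite_subset)
  have "Pow {1..d} - majority d = (\<lambda>A. {1..d} - A) ` majority d"
  proof (intro equalityI subsetI)
    fix A assume A: "A \<in> Pow {1..d} - majority d"
    then have "{1..d} - A \<in> majority d"
      using card_compl[of A] assms by (auto simp: majority_def)
    moreover have "A = {1..d} - ({1..d} - A)" using A by auto
    ultimately show "A \<in> (\<lambda>A. {1..d} - A) ` majority d" by (rule rev_image_eqI)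
  next
    fix A assume "A \<in> (\<lambda>A. {1..d} - A) ` majority d"
    then show "A \<in> Pow {1..d} - majority d"
      using card_compl by (auto simp: majority_def)
  qed
  moreover have "inj_on (\<lambda>A. {1..d} - A) (majority d)"
    by (rule inj_on_subset[of _ "Pow {1..d}"]) (auto simp: inj_on_def majority_def)
  ultimately have "card (Pow {1..d} - majority d) = card (majority d)"
    by (simp add: card_image)
  moreover have "majority d \<subseteq> Pow {1..d}" by (auto simp: majority_def)
  then have "card (Pow {1..d} - majority d) = card (Pow {1..d}) - card (majority d)"
    "card (majority d) \<le> card (Pow {1..d})"
    by (auto intro!: card_Diff_subset card_mono intro: finite_subset)
  moreover have "card (Pow {1..d}) = 2 * 2 ^ (d - 1)"
    using assms by (cases d) (simp_all add: card_Pow)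
  ultimately show ?thesis by simp
qed

lemma majority_insert:
  assumes "A \<in> majority d" "j \<in> {1..d}"
  shows "insert j A \<in> majority d"
proof -
  have "finite A" using assms(1) by (auto simp: majority_def intro: finite_subset)
  then show ?thesis using assms by (auto simp: majority_def card_insert_if)
qed

text \<open>For even \<open>d\<close> the tie-breaking voter 1 is pivotal more often than the
  others. The factor brings this count down to theirs.\<close>

definition rescale_factor :: "nat \<Rightarrow> nat \<Rightarrow> real" where
  "rescale_factor d j = (if even d \<and> j = 1 then (real d - 2) / (2 * (real d - 1)) else 1)"

text \<open>With \<open>d = 2 * Suc k\<close>, the common denominator is the product of the two
  factorials in the denominator of 1/K for even \<open>d\<close>. The second identity includes
  \<open>k = 0\<close>, where both sides are 0; this is the case \<open>d = 2\<close>.\<close>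

lemma central_binomials:
  fixes k :: nat
  shows "real (Suc (2 * k) choose Suc k) = fact (Suc (2 * k)) / (fact k * fact (Suc k))"
    and "real (2 * k choose Suc k) = fact (2 * k) * real k / (fact k * fact (Suc k))"
proof -
  have "fact (Suc k) * fact (Suc (2 * k) - Suc k) * (Suc (2 * k) choose Suc k)
      = (fact (Suc (2 * k)) :: nat)"
    by (rule binomial_fact_lemma) simp
  then have "fact (Suc k) * fact k * real (Suc (2 * k) choose Suc k) = fact (Suc (2 * k))"
    by (metis (no_types, lifting) add_diff_cancel_left' diff_Suc_Suc mult_2 of_nat_fact of_nat_mult)
  then show "real (Suc (2 * k) choose Suc k) = fact (Suc (2 * k)) / (fact k * fact (Suc k))"
    by (simp add: field_simps del: fact_Suc binomial_Suc_Suc)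
  show "real (2 * k choose Suc k) = fact (2 * k) * real k / (fact k * fact (Suc k))"
  proof (cases k)
    case (Suc l)
    have "fact (Suc k) * fact (2 * k - Suc k) * (2 * k choose Suc k) = (fact (2 * k) :: nat)"
      by (rule binomial_fact_lemma) (simp add: Suc)
    moreover have "2 * k - Suc k = l" using Suc by simp
    ultimately have "real (fact (Suc k) * fact l * (2 * k choose Suc k)) = real (fact (2 * k))"
      by metis
    then have "fact (Suc k) * fact l * real (2 * k choose Suc k) = fact (2 * k)"
      by (simp only: of_nat_mult of_nat_fact)
    moreover have "fact k = real k * fact l" by (simp add: Suc)
    ultimately show ?thesis
      by (simp add: field_simps del: fact_Suc binomial_Suc_Suc)
  qed simp
qed

text \<open>The sum counts the coalitions of the other voters for which \<open>j\<close> is pivotal.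
  The count shows which combinatorial quantity 1/K is: up to the factor \<open>2 ^ (d - 1)\<close>,
  the rescaled number of pivotal coalitions, which is the same for every voter.\<close>

lemma majority_influence:
  assumes j: "j \<in> {1..d}"
  shows "rescale_factor d j * (\<Sum>A\<in>majority d. if j \<in> A then 1 else - 1) = 2 ^ (d - 1) / K_const d"
proof -
  let ?P = "{A. A \<subseteq> {1..d} - {j} \<and> A \<notin> majority d \<and> insert j A \<in> majority d}"
  have sum: "(\<Sum>A\<in>majority d. if j \<in> A then 1 else - 1) = real (card ?P)"
    by (rule sum_signs_pivotal) (use j majority_insert in \<open>auto simp: majority_def\<close>)
  have d1: "card ({1..d} - {j}) = d - 1" using j by simp
  have ins: "card (insert j A) = Suc (card A)" if "A \<subseteq> {1..d} - {j}" for A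
    using that by (subst card_insert_disjoint) (auto intro: finite_subset)
  have P: "A \<subseteq> {1..d} - {j} \<and> A \<notin> majority d \<and> insert j A \<in> majority d \<longleftrightarrow> A \<subseteq> {1..d} - {j} \<and>
      (2 * card A < d \<or> 2 * card A = d \<and> 1 \<notin> A) \<and>
      (d < 2 * card A + 2 \<or> d = 2 * card A + 2 \<and> (j = 1 \<or> 1 \<in> A))" for A
    using ins[of A] j by (auto simp: majority_def)
  show ?thesis
  proof (cases "odd d")
    case True
    then obtain k where k: "d = Suc (2 * k)" by (auto elim: oddE)
    have "?P = {A. A \<subseteq> {1..d} - {j} \<and> card A = k}"
      unfolding P unfolding k by (intro Collect_cong conj_cong refl) (auto; arith)
    then have "card ?P = (d - 1 choose k)"
      using n_subsets[of "{1..d} - {j}" k] d1 by simp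
    then show ?thesis
      unfolding sum using k by (simp add: rescale_factor_def K_const_def)
  next
    case False
    then have "d = 2 * Suc (d div 2 - 1)" using j by auto
    then obtain k where k: "d = 2 * Suc k" by blast
    \<comment> \<open>The voter \<open>j\<close> is pivotal in two ways: in \<open>?L\<close>
      joining produces a tie that voter 1 decides in favour, in \<open>?R\<close> joining turns a
      tie lost for want of voter 1 into a strict majority.\<close>
    let ?L = "{A. A \<subseteq> {1..d} - {j} \<and> card A = k \<and> (j = 1 \<or> 1 \<in> A)}"
      and ?R = "{A. A \<subseteq> {1..d} - {j} \<and> card A = Suc k \<and> 1 \<notin> A}"
    have "?P = ?L \<union> ?R"
      unfolding P unfolding k Un_def mem_Collect_eq by (intro Collect_cong) (auto; arith)
    moreover have fin: "finite ?L" "finite ?R"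
      by (auto intro: finite_subset[of _ "Pow {1..d}"])
    moreover have "?L \<inter> ?R = {}" by auto
    ultimately have card_P: "card ?P = card ?L + card ?R"
      by (simp add: card_Un_disjoint)
    \<comment> \<open>For \<open>k = 0\<close> both sides are 0, since \<open>K_const 2\<close> is 0
      and division by 0 gives 0.\<close>
    have K: "2 ^ (d - 1) / K_const d = 2 * real (2 * k choose Suc k)"
      unfolding central_binomials by (simp add: K_const_def k field_simps del: fact_Suc)
    show ?thesis
    proof (cases "j = 1")
      case True
      have "?L = {A. A \<subseteq> {1..d} - {j} \<and> card A = k}"
        "?R = {A. A \<subseteq> {1..d} - {j} \<and> card A = Suc k}" using True by auto
      then have "card ?P = (Suc (2 * k) choose k) + (Suc (2 * k) choose Suc k)"
        unfolding card_P using d1 k by (simp add: n_subsets)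
      also have "(Suc (2 * k) choose k) = (Suc (2 * k) choose Suc k)"
        by (subst binomial_symmetric) (auto simp: Suc_diff_le)
      finally have rescaled: "rescale_factor d j * card ?P
          = real k / (2 * real k + 1) * (2 * real (Suc (2 * k) choose Suc k))"
        using True k by (simp add: rescale_factor_def field_simps del: binomial_Suc_Suc)
      \<comment> \<open>The denominator of the rescaling is the leading factor of
        \<open>fact (Suc (2 * k))\<close>; cancelling it turns the count for voter 1 into the count
        for the other voters.\<close>
      have cancel: "real k / (2 * real k + 1) * (2 * ((2 * real k + 1) * x)) = 2 * (real k * x)" for x
        using of_nat_0_le_iff[of k, where 'a = real] by (simp add: add_nonneg_eq_0_iff)
      note rescaled
      also have "real (Suc (2 * k) choose Suc k)
          = (2 * real k + 1) * (fact (2 * k) / (fact k * fact (Suc k)))"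
        unfolding central_binomials fact_Suc[of "2 * k"] by (simp del: fact_Suc)
      also have "real k / (2 * real k + 1) * (2 * \<dots>)
          = 2 * (real k * (fact (2 * k) / (fact k * fact (Suc k))))"
        using cancel by simp
      also have "\<dots> = 2 ^ (d - 1) / K_const d"
        unfolding K central_binomials by (simp del: fact_Suc)
      finally show ?thesis unfolding sum .
    next
      case False
      let ?U = "{1..d} - {j}"
      have R: "?R = {A. A \<subseteq> {1..d} - {j} - {1} \<and> card A = Suc k}" by auto
      have "card ({1..d} - {j} - {1}) = 2 * k" using j False k by simp
      then have card_R: "card ?R = (2 * k choose Suc k)"
        unfolding R by (simp add: n_subsets)
      have card_compl: "card (?U - A) = 2 * k + 1 - card A" if "A \<subseteq> ?U" for A
        using that d1 k by (subst card_Diff_subset) (auto intro: finite_subset)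
      \<comment> \<open>There are \<open>2 * k + 1\<close> voters other than \<open>j\<close>, among
        them voter 1. Complementing within them exchanges sizes \<open>k\<close> and
        \<open>Suc k\<close>, and exchanges the sets with and without voter 1.\<close>
      have "(\<lambda>A. ?U - A) ` ?L = ?R"
      proof (intro equalityI subsetI)
        fix A assume "A \<in> (\<lambda>A. ?U - A) ` ?L"
        then show "A \<in> ?R" using card_compl False by auto
      next
        fix A assume A: "A \<in> ?R"
        then have "A = ?U - (?U - A)" by auto
        moreover have "?U - A \<in> ?L" using A card_compl[of A] False j by auto
        ultimately show "A \<in> (\<lambda>A. ?U - A) ` ?L" by (rule image_eqI)
      qed
      moreover have "inj_on (\<lambda>A. ?U - A) (Pow ?U)" by (auto simp: inj_on_def)
      then have "inj_on (\<lambda>A. ?U - A) ?L" by (rule inj_on_subset) auto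
      then have "card ((\<lambda>A. ?U - A) ` ?L) = card ?L" by (rule card_image)
      ultimately have "card ?L = card ?R" by (simp only:)
      with card_R card_P have "card ?P = 2 * (2 * k choose Suc k)" by simp
      then show ?thesis
        unfolding sum K using False by (simp add: rescale_factor_def)
    qed
  qed
qed

section \<open>From majority votes to the mean of the mechanism\<close>

text \<open>A point of the cube is coded by the set A of coordinates in which it equals
  \<open>B * v j\<close>. Its inner product with \<open>v\<close> is then B (2 card A - d), and the
  tie rule reads 1 \<in> A. As \<open>B > 0\<close>, the two signs differ and the coding is
  injective.\<close>

lemma agreeing_eq_image_majority:
  assumes B: "B > 0" and d: "d \<ge> 1" and v: "\<And>j. j \<in> {1..d} \<Longrightarrow> v j \<in> {- 1, 1}"
  defines "z \<equiv> \<lambda>A. \<lambda>j\<in>{1..d}. B * (if j \<in> A then v j else - v j)"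
  shows "agreeing d B v = z ` majority d" and "inj_on z (majority d)"
proof -
  have vv: "v j * v j = 1" if "j \<in> {1..d}" for j using v[OF that] by auto
  have sum: "(\<Sum>j = 1..d. z A j * v j) = B * (2 * real (card A) - real d)" if "A \<subseteq> {1..d}" for A
  proof -
    have "(\<Sum>j = 1..d. z A j * v j) = (\<Sum>j = 1..d. if j \<in> A then B else - B)"
      by (intro sum.cong refl) (auto simp: z_def vv mult.assoc)
    also have "\<dots> = B * real (card A) - B * real (card ({1..d} - A))"
      using that by (simp add: sum.If_cases Int_absorb1 Diff_eq)
    also have "card ({1..d} - A) = d - card A"
      using that by (subst card_Diff_subset) (auto intro: finite_subset)
    finally show ?thesis
      using card_mono[OF _ that] by (simp add: of_nat_diff algebra_simps)
  qed
  have maj: "z A \<in> agreeing d B v \<longleftrightarrow> A \<in> majority d" if "A \<subseteq> {1..d}" for A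
  proof -
    have "z A \<in> {1..d} \<rightarrow>\<^sub>E {- B, B}" using v by (force simp: z_def)
    moreover have "z A 1 = B * v 1 \<longleftrightarrow> 1 \<in> A"
      using B d v[of 1] by (auto simp: z_def)
    moreover have "B * (2 * real (card A) - real d) > 0 \<longleftrightarrow> d < 2 * card A"
      "B * (2 * real (card A) - real d) = 0 \<longleftrightarrow> d = 2 * card A"
      using B by (auto simp: zero_less_mult_iff)
    ultimately show ?thesis
      unfolding agreeing_def majority_def using that sum[OF that] by auto
  qed
  show "agreeing d B v = z ` majority d"
  proof (intro equalityI subsetI)
    fix y assume y: "y \<in> agreeing d B v"
    define A where "A = {j \<in> {1..d}. y j = B * v j}"
    have yP: "y \<in> {1..d} \<rightarrow>\<^sub>E {- B, B}" using y by (simp add: agreeing_def)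
    have "y = z A"
    proof
      fix j show "y j = z A j"
      proof (cases "j \<in> {1..d}")
        case True
        then show ?thesis using PiE_mem[OF yP True] v[OF True] by (auto simp: z_def A_def)
      next
        case False
        then show ?thesis using PiE_arb[OF yP False] by (auto simp: z_def)
      qed
    qed
    moreover have "A \<subseteq> {1..d}" by (auto simp: A_def)
    ultimately show "y \<in> z ` majority d" using maj y by blast
  next
    fix y assume "y \<in> z ` majority d"
    then show "y \<in> agreeing d B v" using maj by (auto simp: majority_def)
  qed
  show "inj_on z (majority d)"
  proof (rule inj_onI)
    fix A A' assume A: "A \<in> majority d" "A' \<in> majority d" "z A = z A'"
    have "j \<in> A \<longleftrightarrow> j \<in> A'" if "j \<in> {1..d}" for j
      using fun_cong[OF A(3), of j] that v[OF that] B by (auto simp: z_def split: if_splits)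
    then show "A = A'" using A(1,2) unfolding majority_def by blast
  qed
qed

lemma rescale_first_eq:
  "rescale_first d z j = rescale_factor d j * z j"
  by (auto simp: rescale_first_def rescale_factor_def)

text \<open>Through the coding by majorities, the sum over the set is \<open>B * v j\<close> times
  the rescaled pivotal count, and the set has \<open>2 ^ (d - 1)\<close> elements.\<close>

lemma expectation_agreeing:
  assumes B: "B > 0" and v: "\<And>j. j \<in> {1..d} \<Longrightarrow> v j \<in> {- 1, 1}" and j: "j \<in> {1..d}"
  shows "measure_pmf.expectation (pmf_of_set (agreeing d B v)) (\<lambda>z. rescale_first d z j)
    = B * v j / K_const d"
proof -
  have d: "d \<ge> 1" using j by simp
  define z where "z = (\<lambda>A. \<lambda>j\<in>{1..d}. B * (if j \<in> A then v j else - v j))"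
  have im: "agreeing d B v = z ` majority d" "inj_on z (majority d)"
    unfolding z_def by (rule agreeing_eq_image_majority[OF B d]; use v in blast)+
  have card: "card (agreeing d B v) = 2 ^ (d - 1)"
    using card_image[OF im(2)] card_majority[OF d] im(1) by simp
  then have "agreeing d B v \<noteq> {}" by auto
  then have "measure_pmf.expectation (pmf_of_set (agreeing d B v)) (\<lambda>z. rescale_first d z j)
      = (\<Sum>z\<in>agreeing d B v. rescale_factor d j * z j) / 2 ^ (d - 1)"
    using finite_agreeing by (subst integral_pmf_of_set) (simp_all add: card rescale_first_eq)
  also have "(\<Sum>z\<in>agreeing d B v. rescale_factor d j * z j)
      = (\<Sum>A\<in>majority d. rescale_factor d j * z A j)"
    unfolding im(1) by (subst sum.reindex[OF im(2)]) simp
  also have "\<dots> = B * v j * (rescale_factor d j * (\<Sum>A\<in>majority d. if j \<in> A then 1 else - 1))"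
    unfolding sum_distrib_left using j by (intro sum.cong) (auto simp: z_def)
  finally show ?thesis by (simp add: majority_influence[OF j])
qed

text \<open>The untruthful draw is thus the truthful one for the negated signs, with mean of
  opposite sign.\<close>

lemma opposing_eq_agreeing: "opposing d B v = agreeing d B (\<lambda>j. - v j)"
  by (simp add: opposing_def agreeing_def sum_negf)

lemma K_const_pos:
  assumes "d \<ge> 1" "d \<noteq> 2"
  shows "K_const d > 0"
proof -
  have "odd d \<or> d - 2 > 0" using assms by presburger
  then show ?thesis by (auto simp: K_const_def)
qed

lemma B_const_nonneg: "\<alpha> > 0 \<Longrightarrow> B_const \<alpha> d \<ge> 0"
  by (auto simp: B_const_def K_const_def)

lemma B_const_pos:
  assumes "\<alpha> > 0" "d \<ge> 1" "d \<noteq> 2"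
  shows "B_const \<alpha> d > 0"
  unfolding B_const_def using assms K_const_pos[of d]
  by (intro mult_pos_pos divide_pos_pos add_pos_pos) auto

text \<open>The two draws have means \<plusminus>(B/K) v and probabilities p and 1 - p, so the mean
  is (2p - 1)(B/K) v. The constant B is chosen to make the scalar factor 1, which fails for
  \<open>d = 2\<close>, where \<open>B_const\<close> is 0.\<close>

lemma expectation_privatize:
  assumes "\<alpha> > 0" "d \<noteq> 2" and j: "j \<in> {1..d}"
  shows "measure_pmf.expectation (privatize \<alpha> d x) (\<lambda>z. z j) = sgn1 (x j)"
proof -
  define B where "B = B_const \<alpha> d"
  define v where "v = sgn_vec d x"
  define p where "p = exp \<alpha> / (exp \<alpha> + 1)"
  have K: "K_const d > 0" using assms by (intro K_const_pos) auto
  have B: "B > 0" using B_const_pos[of \<alpha> d] assms by (simp add: B_def)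
  have v: "v j \<in> {- 1, 1}" "- v j \<in> {- 1, 1}" if "j \<in> {1..d}" for j
    using that by (auto simp: v_def sgn_vec_def sgn1_def)
  have p: "0 \<le> p" "p \<le> 1" by (auto simp: p_def add_pos_pos)
  let ?f = "\<lambda>y. map_pmf (rescale_first d) (pmf_of_set (if y then agreeing d B v else opposing d B v))"
  have ne: "agreeing d B v \<noteq> {}" "opposing d B v \<noteq> {}"
    using agreeing_opposing_nonempty[of B d x] B j by (auto simp: v_def)
  have "measure_pmf.expectation (privatize \<alpha> d x) (\<lambda>z. z j)
      = (\<Sum>y\<in>UNIV. pmf (bernoulli_pmf p) y *\<^sub>R measure_pmf.expectation (?f y) (\<lambda>z. z j))"
    unfolding privatize_def B_def[symmetric] v_def[symmetric] p_def[symmetric]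
    by (rule pmf_expectation_bind) (use ne finite_agreeing finite_opposing in auto)
  also have "\<dots> = p * (B * v j / K_const d) + (1 - p) * (B * - v j / K_const d)"
    using p expectation_agreeing[OF B v(1) j] expectation_agreeing[OF B v(2) j]
    by (simp add: UNIV_bool opposing_eq_agreeing)
  also have "\<dots> = (2 * p - 1) * (B / K_const d) * v j" using K by (simp add: field_simps)
  also have "2 * p - 1 = (exp \<alpha> - 1) / (exp \<alpha> + 1)"
    by (simp add: p_def field_simps add_pos_pos less_imp_neq[symmetric])
  also have "\<dots> * (B / K_const d) = 1"
    using K \<open>\<alpha> > 0\<close> by (simp add: B_def B_const_def add_pos_pos less_imp_neq[symmetric])
  finally show ?thesis using j by (simp add: v_def sgn_vec_def)
qed

lemma privatize_bounded:
  assumes "z \<in> set_pmf (privatize \<alpha> d x)" "\<alpha> > 0" "j \<in> {1..d}"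
  shows "\<bar>z j\<bar> \<le> B_const \<alpha> d"
proof -
  define B where "B = B_const \<alpha> d"
  have B: "B \<ge> 0" using \<open>\<alpha> > 0\<close> by (simp add: B_def B_const_nonneg)
  have ne: "agreeing d B (sgn_vec d x) \<noteq> {}" "opposing d B (sgn_vec d x) \<noteq> {}"
    using agreeing_opposing_nonempty[of B d x] B assms(3) by auto
  have "z \<in> rescale_first d ` (agreeing d B (sgn_vec d x) \<union> opposing d B (sgn_vec d x))"
    using assms(1) ne finite_agreeing[of d B] finite_opposing[of d B]
    by (auto simp: privatize_def B_def[symmetric] split: if_splits)
  then obtain y where y: "y \<in> agreeing d B (sgn_vec d x) \<union> opposing d B (sgn_vec d x)"
    "z = rescale_first d y" by blast
  then have "y \<in> {1..d} \<rightarrow>\<^sub>E {- B, B}" by (auto simp: agreeing_def opposing_def)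
  from PiE_mem[OF this assms(3)] have "\<bar>y j\<bar> = B" using B by auto
  \<comment> \<open>Rescaling never enlarges a coordinate, so the bound for the cube
    survives.\<close>
  moreover have "\<bar>rescale_factor d j\<bar> \<le> 1"
    using assms(3) by (auto simp: rescale_factor_def abs_le_iff field_simps)
  ultimately show ?thesis
    using B mult_left_le_one_le[of "\<bar>y j\<bar>" "\<bar>rescale_factor d j\<bar>"]
    by (simp add: y(2) rescale_first_eq abs_mult B_def)
qed


section \<open>Risk of the selector\<close>

text \<open>Independence means that the joint law is the product of the marginal laws. Here the
  joint map is the identity on the product space, and the marginals are the factors.\<close>

lemma indep_vars_PiM_components:
  assumes "\<And>i. i \<in> I \<Longrightarrow> prob_space (M i)" "I \<noteq> {}"
  shows "prob_space.indep_vars (PiM I M) M (\<lambda>i x. x i) I"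
proof -
  interpret prob_space "PiM I M" using assms(1) by (rule prob_space_PiM)
  have "distr (PiM I M) (PiM I M) (\<lambda>x. \<lambda>i\<in>I. x i) = distr (PiM I M) (PiM I M) (\<lambda>x. x)"
    by (intro distr_cong refl) (auto simp: space_PiM)
  also have "\<dots> = PiM I M" by (simp add: distr_id)
  also have "\<dots> = PiM I (\<lambda>i. distr (PiM I M) (M i) (\<lambda>x. x i))"
    using assms(1) by (intro PiM_cong refl) (simp add: distr_PiM_component)
  finally show ?thesis
    by (subst indep_vars_iff_distr_eq_PiM'[OF assms(2)]) auto
qed

lemma borel_measurable_sgn1 [measurable]: "sgn1 \<in> borel_measurable borel"
  unfolding sgn1_def by measurable

locale privacy_model =
  fixes \<alpha> \<sigma> :: real and d :: nat and \<nu> :: "real measure"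
  assumes \<alpha>: "\<alpha> > 0" and \<sigma>: "\<sigma> > 0"
    and prob_noise: "prob_space \<nu>" and sets_noise: "sets \<nu> = sets borel"
begin

abbreviation "Z_law \<theta> \<equiv> private_law \<alpha> d \<sigma> \<nu> \<theta>"

text \<open>Because \<open>sgn1\<close> is 1 at 0, \<open>sgn1 (m + \<sigma> * u)\<close> is exactly
  twice the indicator of a closed half-line minus 1; symmetry turns its mean into the mass of an
  interval.\<close>

lemma expectation_sgn1_shift:
  assumes "distr \<nu> borel uminus = \<nu>" "m \<ge> 0"
  shows "(\<integral>u. sgn1 (m + \<sigma> * u) \<partial>\<nu>) = measure \<nu> {- (m / \<sigma>)..m / \<sigma>}"
proof -
  interpret prob_space \<nu> by (rule prob_noise)
  have *: "{- (m / \<sigma>)..} \<in> sets \<nu>" by (simp add: sets_noise)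
  have "(\<integral>u. sgn1 (m + \<sigma> * u) \<partial>\<nu>) = (\<integral>u. 2 * indicator {- (m / \<sigma>)..} u - 1 \<partial>\<nu>)"
    using \<sigma> by (intro Bochner_Integration.integral_cong refl)
      (auto simp: sgn1_def field_simps split: split_indicator)
  also have "\<dots> = 2 * measure \<nu> {- (m / \<sigma>)..} - 1"
    using * prob_space sets_eq_imp_space_eq[OF sets_noise]
    by (subst Bochner_Integration.integral_diff) (auto simp: emeasure_eq_measure)
  also have "\<dots> = measure \<nu> {- (m / \<sigma>)..m / \<sigma>}"
    using measure_symmetric_interval(1)[OF prob_noise sets_noise assms(1), of "m / \<sigma>"] assms(2) \<sigma>
    by simp
  finally show ?thesis .
qed

lemma measurable_shift:
  "(\<lambda>\<xi>. \<lambda>j\<in>{1..d}. \<theta> j + \<sigma> * \<xi> j) \<in> measurable (\<Pi>\<^sub>M j\<in>{1..d}. \<nu>) (\<Pi>\<^sub>M j\<in>{1..d}. borel)"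
proof (intro measurable_restrict borel_measurable_add borel_measurable_times borel_measurable_const)
  fix j assume "j \<in> {1..d}"
  then show "(\<lambda>\<xi>. \<xi> j) \<in> borel_measurable (\<Pi>\<^sub>M j\<in>{1..d}. \<nu>)"
    using measurable_component_singleton[of j "{1..d}" "\<lambda>_. \<nu>"]
      measurable_cong_sets[OF refl sets_noise] by blast
qed

lemma prob_space_data_law: "prob_space (data_law d \<sigma> \<nu> \<theta>)"
  unfolding data_law_def
  by (intro prob_space.prob_space_distr measurable_shift prob_space_PiM prob_noise)

lemma privatize_kernel:
  "(\<lambda>x. measure_pmf (privatize \<alpha> d x))
     \<in> measurable (data_law d \<sigma> \<nu> \<theta>) (subprob_algebra (count_space UNIV))"
  using privatize_measurable by (simp add: data_law_def)

lemma AE_private_law_bounded: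
  assumes "j \<in> {1..d}"
  shows "AE z in Z_law \<theta>. \<bar>z j\<bar> \<le> B_const \<alpha> d"
  unfolding private_law_def
  by (subst AE_bind[OF privatize_kernel])
    (auto simp: AE_measure_pmf_iff intro!: AE_I2 privatize_bounded \<alpha> assms[simplified])

text \<open>The mechanism takes values in \<open>count_space UNIV\<close>, so every set is
  measurable for the law of the output.\<close>

lemma measurable_private_law [measurable]:
  "f \<in> borel_measurable (Z_law \<theta>)"
  by (rule measurableI) (auto simp: sets_private_law[OF prob_noise sets_noise])

lemma expectation_private_law:
  assumes "distr \<nu> borel uminus = \<nu>" "d \<noteq> 2" and j: "j \<in> {1..d}" and "\<theta> j \<ge> 0"
  shows "(\<integral>z. z j \<partial>Z_law \<theta>) = measure \<nu> {- (\<theta> j / \<sigma>)..\<theta> j / \<sigma>}"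
proof -
  interpret D: prob_space "data_law d \<sigma> \<nu> \<theta>" by (rule prob_space_data_law)
  define B where "B = B_const \<alpha> d"
  \<comment> \<open>Integration against the kernel by \<open>integral_bind\<close> asks for a bound
    at every point, whereas \<open>z j\<close> is bounded only almost surely. The clipped coordinate
    is bounded everywhere and agrees with \<open>z j\<close> on the outputs of the
    mechanism.\<close>
  define clip where "clip z = max (- B) (min B (z j))" for z :: "nat \<Rightarrow> real"
  have clip: "clip z = z j" if "\<bar>z j\<bar> \<le> B" for z
    using that by (auto simp: clip_def)
  have "(\<integral>z. z j \<partial>Z_law \<theta>) = (\<integral>z. clip z \<partial>Z_law \<theta>)"
    using AE_private_law_bounded[OF j, of \<theta>]
    by (intro integral_cong_AE measurable_private_law) (auto simp: clip B_def elim: eventually_mono)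
  also have "\<dots> = (\<integral>x. \<integral>z. clip z \<partial>privatize \<alpha> d x \<partial>data_law d \<sigma> \<nu> \<theta>)"
    unfolding private_law_def
  proof (rule integral_bind[OF _ _ privatize_kernel])
    show "\<bar>clip z\<bar> \<le> B" for z
      using B_const_nonneg[OF \<alpha>, of d] by (auto simp: clip_def B_def)
    show "AE x in data_law d \<sigma> \<nu> \<theta>. emeasure (measure_pmf (privatize \<alpha> d x))
        (space (measure_pmf (privatize \<alpha> d x))) \<le> ennreal 1"
      by (intro AE_I2) (simp add: measure_pmf.emeasure_space_1)
  qed (auto intro: D.finite_measure_axioms)
  also have "\<dots> = (\<integral>x. sgn1 (x j) \<partial>data_law d \<sigma> \<nu> \<theta>)"
  proof (intro Bochner_Integration.integral_cong refl)
    fix x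
    have "(\<integral>z. clip z \<partial>privatize \<alpha> d x) = (\<integral>z. z j \<partial>privatize \<alpha> d x)"
      by (intro integral_cong_AE)
        (auto simp: AE_measure_pmf_iff B_def intro!: clip privatize_bounded \<alpha> j[simplified])
    then show "(\<integral>z. clip z \<partial>privatize \<alpha> d x) = sgn1 (x j)"
      using expectation_privatize[OF \<alpha> assms(2) j] by simp
  qed
  also have "\<dots> = (\<integral>\<xi>. sgn1 (\<theta> j + \<sigma> * \<xi> j) \<partial>(\<Pi>\<^sub>M j\<in>{1..d}. \<nu>))"
    unfolding data_law_def using j by (subst integral_distr[OF measurable_shift]) auto
  also have "\<dots> = (\<integral>u. sgn1 (\<theta> j + \<sigma> * u) \<partial>distr (\<Pi>\<^sub>M j\<in>{1..d}. \<nu>) \<nu> (\<lambda>\<xi>. \<xi> j))"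
  proof (subst integral_distr)
    show "(\<lambda>u. sgn1 (\<theta> j + \<sigma> * u)) \<in> borel_measurable \<nu>"
      unfolding measurable_cong_sets[OF sets_noise refl] by measurable
  qed (use j in auto)
  also have "distr (\<Pi>\<^sub>M j\<in>{1..d}. \<nu>) \<nu> (\<lambda>\<xi>. \<xi> j) = \<nu>"
    using distr_PiM_component[of "{1..d}" "\<lambda>_. \<nu>" j] prob_noise j by simp
  finally show ?thesis using expectation_sgn1_shift assms by simp
qed

section \<open>Tail bounds and the total risk\<close>

lemma sample_mean_tails:
  fixes \<theta> :: "nat \<Rightarrow> real"
  assumes j: "j \<in> {1..d}" and d: "d \<noteq> 2" and n: "n \<ge> 1" and \<epsilon>: "\<epsilon> \<ge> 0"
  defines "P \<equiv> private_sample \<alpha> d n \<sigma> \<nu> \<theta>" and "\<mu> \<equiv> \<integral>z. z j \<partial>Z_law \<theta>"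
    and "e \<equiv> exp (- (real n * \<epsilon>\<^sup>2 / (2 * (B_const \<alpha> d)\<^sup>2)))"
  shows "measure P {Z \<in> space P. 1 / real n * (\<Sum>i = 1..n. Z i j) \<ge> \<mu> + \<epsilon>} \<le> e"
    and "measure P {Z \<in> space P. 1 / real n * (\<Sum>i = 1..n. Z i j) \<le> \<mu> - \<epsilon>} \<le> e"
proof -
  note law = prob_space_private_law[OF prob_noise sets_noise]
  interpret prob_space P
    unfolding P_def by (rule prob_space_private_sample[OF prob_noise sets_noise])
  define B where "B = B_const \<alpha> d"
  have B: "B > 0" using B_const_pos[OF \<alpha>] j d by (simp add: B_def)
  have comp: "(\<lambda>Z. Z i) \<in> measurable P (Z_law \<theta>)" if "i \<in> {1..n}" for i
    unfolding P_def private_sample_def using that by (rule measurable_component_singleton)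
  have distr_comp: "distr P (Z_law \<theta>) (\<lambda>Z. Z i) = Z_law \<theta>" if "i \<in> {1..n}" for i
    unfolding P_def private_sample_def using law that by (rule distr_PiM_component)
  have distr_X: "distr P borel (\<lambda>Z. Z i j) = distr (Z_law \<theta>) borel (\<lambda>z. z j)"
    if i: "i \<in> {1..n}" for i
    using distr_distr[OF measurable_private_law comp[OF i], of "\<lambda>z. z j"]
    by (simp add: distr_comp[OF i] comp_def)
  have one: "1 \<in> {1..n}" using n by simp
  have indep: "indep_vars (\<lambda>_. borel) (\<lambda>i Z. Z i j) {1..n}"
    unfolding P_def private_sample_def using n law
    by (intro prob_space.indep_vars_compose2[OF prob_space_PiM indep_vars_PiM_components]) auto
  interpret H: Hoeffding_ineq_iid P "{1..n}" "\<lambda>i Z. Z i j" "\<lambda>Z. Z 1 j" "- B" B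
    "expectation (\<lambda>Z. Z 1 j)"
  proof unfold_locales
    show "indep_vars (\<lambda>_. borel) (\<lambda>i Z. Z i j) {1..n}" by (rule indep)
    show "distr P borel (\<lambda>Z. Z i j) = distr P borel (\<lambda>Z. Z 1 j)" if "i \<in> {1..n}" for i
      unfolding distr_X[OF that] distr_X[OF one] ..
    show "random_variable borel (\<lambda>Z. Z 1 j)"
      using measurable_compose[OF comp[OF one] measurable_private_law] .
    have "AE z in distr P (Z_law \<theta>) (\<lambda>Z. Z 1). z j \<in> {- B..B}"
      using AE_private_law_bounded[OF j] unfolding distr_comp[OF one]
      by (rule eventually_mono) (auto simp: B_def)
    then show "AE Z in P. Z 1 j \<in> {- B..B}"
      by (rule AE_distrD[OF comp[OF one]])
  qed simp
  have "expectation (\<lambda>Z. Z 1 j) = (\<integral>z. z j \<partial>distr P (Z_law \<theta>) (\<lambda>Z. Z 1))"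
    by (subst integral_distr[OF comp[OF one]]) auto
  then have \<mu>: "expectation (\<lambda>Z. Z 1 j) = \<mu>" unfolding \<mu>_def distr_comp[OF one] .
  \<comment> \<open>The range of each summand has length 2B, so the exponent of Hoeffding's
    inequality loses a factor 4.\<close>
  have e: "exp (- 2 * real (card {1..n}) * \<epsilon>\<^sup>2 / (B - - B)\<^sup>2) = e"
    by (simp add: e_def B_def[symmetric] power2_eq_square)
  have mean: "1 / real n * x = x / real (card {1..n})" for x by simp
  have "- B < B" "{1..n} \<noteq> {}" using B n by auto
  from H.Hoeffding_ineq_ge'[OF \<epsilon> this] H.Hoeffding_ineq_le'[OF \<epsilon> this]
  show "measure P {Z \<in> space P. 1 / real n * (\<Sum>i = 1..n. Z i j) \<ge> \<mu> + \<epsilon>} \<le> e"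
    and "measure P {Z \<in> space P. 1 / real n * (\<Sum>i = 1..n. Z i j) \<le> \<mu> - \<epsilon>} \<le> e"
    unfolding \<mu> e mean .
qed

text \<open>The expected Hamming loss is the sum of the error probabilities of the coordinates. Off
  the support the mean is 0 and an error is an upward deviation of at least \<open>\<tau>\<close>;
  on it the mean is at least \<open>C\<close> and an error is a downward deviation of more than
  \<open>C - \<tau>\<close>.\<close>

lemma selector_risk_bound:
  assumes sym: "distr \<nu> borel uminus = \<nu>" and n: "n \<ge> 1" and a: "a > 0"
    and atom: "measure \<nu> {0} = 0"
    and \<tau>: "0 \<le> \<tau>" "\<tau> < C" and C: "C \<le> measure \<nu> {- (a / \<sigma>)..a / \<sigma>}"
    and \<theta>: "\<theta> \<in> sparse_nonneg d s a"
  defines "e \<equiv> \<lambda>t. exp (- (real n * t\<^sup>2 / (2 * (B_const \<alpha> d)\<^sup>2)))"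
  shows "(\<integral>Z. hamming d (selector n \<tau> Z) (pattern \<theta>) \<partial>private_sample \<alpha> d n \<sigma> \<nu> \<theta>)
    \<le> (real d - real (card (supp d \<theta>))) * e \<tau> + real (card (supp d \<theta>)) * e (C - \<tau>)"
proof -
  define P where "P = private_sample \<alpha> d n \<sigma> \<nu> \<theta>"
  interpret prob_space P
    unfolding P_def by (rule prob_space_private_sample[OF prob_noise sets_noise])
  have [measurable]: "(\<lambda>Z. Z i j) \<in> borel_measurable P" if "i \<in> {1..n}" for i j
    unfolding P_def private_sample_def
    using measurable_compose[OF measurable_component_singleton[OF that] measurable_private_law]
    by simp
  have mean [measurable]: "(\<lambda>Z. 1 / real n * (\<Sum>i = 1..n. Z i j)) \<in> borel_measurable P" for j
    by measurable
  have \<theta>_cases: "\<theta> j = 0 \<or> \<theta> j \<ge> a" if "j \<in> {1..d}" for j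
    using \<theta> that unfolding sparse_nonneg_def by blast
  define err where "err j = {Z \<in> space P. selector n \<tau> Z j \<noteq> pattern \<theta> j}" for j
  have err [measurable]: "err j \<in> sets P" for j
    unfolding err_def selector_def by measurable
  have err_bound: "prob (err j) \<le> (if j \<in> supp d \<theta> then e (C - \<tau>) else e \<tau>)"
    if j: "j \<in> {1..d}" for j
  proof (cases "d = 2")
    \<comment> \<open>Here \<open>B_const\<close> is 0, both exponents are 0 and the bound is
      1.\<close>
    case True
    then show ?thesis by (simp add: e_def B_const_def K_const_def)
  next
    case False
    let ?\<mu> = "\<integral>z. z j \<partial>Z_law \<theta>"
    have \<theta>0: "\<theta> j \<ge> 0" using \<theta>_cases[OF j] a by auto
    note \<mu> = expectation_private_law[where \<theta> = \<theta>, OF sym False j \<theta>0]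
    note tails = sample_mean_tails[where \<theta> = \<theta>, OF j False n, folded P_def]
    show ?thesis
    proof (cases "\<theta> j = 0")
      case True
      have "?\<mu> = 0" using \<mu> True atom by simp
      then have "prob (err j) \<le> e \<tau>"
        using tails(1)[OF \<tau>(1)] True
        by (simp add: err_def e_def selector_def pattern_def)
      then show ?thesis using True by (simp add: supp_def)
    next
      case nz: False
      then have "a / \<sigma> \<le> \<theta> j / \<sigma>" using \<theta>_cases[OF j] \<sigma> by (simp add: divide_right_mono)
      interpret N: prob_space \<nu> by (rule prob_noise)
      have "measure \<nu> {- (a / \<sigma>)..a / \<sigma>} \<le> ?\<mu>"
        unfolding \<mu> using \<open>a / \<sigma> \<le> \<theta> j / \<sigma>\<close>
        by (intro N.finite_measure_mono) (auto simp: sets_noise)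
      with C have "C \<le> ?\<mu>" by simp
      \<comment> \<open>The deviation is measured from the true mean, so that the threshold is
        exactly \<open>\<tau>\<close>; afterwards \<open>?\<mu>\<close> is replaced by its lower
        bound \<open>C\<close>, using that \<open>e\<close> decreases on nonnegative
        arguments.\<close>
      with \<tau> have "prob {Z \<in> space P. 1 / real n * (\<Sum>i = 1..n. Z i j) \<le> ?\<mu> - (?\<mu> - \<tau>)} \<le> e (?\<mu> - \<tau>)"
        unfolding e_def by (intro tails(2)) simp
      moreover have "prob (err j) \<le> prob {Z \<in> space P. 1 / real n * (\<Sum>i = 1..n. Z i j) \<le> ?\<mu> - (?\<mu> - \<tau>)}"
        using nz by (intro finite_measure_mono) (auto simp: err_def selector_def pattern_def)
      moreover have "e (?\<mu> - \<tau>) \<le> e (C - \<tau>)"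
        unfolding e_def using \<open>C \<le> ?\<mu>\<close> \<tau>
        by (auto intro!: divide_right_mono mult_left_mono power_mono)
      ultimately show ?thesis using nz j by (simp add: supp_def)
    qed
  qed
  have "(\<integral>Z. hamming d (selector n \<tau> Z) (pattern \<theta>) \<partial>P)
      = (\<integral>Z. (\<Sum>j = 1..d. indicator (err j) Z) \<partial>P)"
    unfolding hamming_def
    by (intro Bochner_Integration.integral_cong refl sum.cong) (auto simp: err_def split: split_indicator)
  also have "\<dots> = (\<Sum>j = 1..d. prob (err j))"
    by (subst Bochner_Integration.integral_sum) (auto simp: emeasure_eq_measure)
  also have "\<dots> \<le> (\<Sum>j = 1..d. if j \<in> supp d \<theta> then e (C - \<tau>) else e \<tau>)"
    by (intro sum_mono err_bound)
  also have "\<dots> = real (card (supp d \<theta>)) * e (C - \<tau>) + real (card ({1..d} - supp d \<theta>)) * e \<tau>"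
  proof -
    have "{1..d} \<inter> {j. j \<in> supp d \<theta>} = supp d \<theta>"
      "{1..d} \<inter> - {j. j \<in> supp d \<theta>} = {1..d} - supp d \<theta>"
      by (auto simp: supp_def)
    then show ?thesis by (simp add: sum.If_cases)
  qed
  also have "real (card ({1..d} - supp d \<theta>)) = real d - real (card (supp d \<theta>))"
  proof -
    have sub: "supp d \<theta> \<subseteq> {1..d}" by (auto simp: supp_def)
    show ?thesis
      using card_mono[OF _ sub] finite_subset[OF sub]
      by (subst card_Diff_subset[OF _ sub]) (simp_all add: of_nat_diff)
  qed
  finally show ?thesis by (simp add: P_def)
qed

end

theorem proposition3p3:
  fixes \<sigma> \<alpha> a c C1 :: real and n s d :: nat and \<nu> :: "real measure"
  assumes "\<sigma> > 0" and "\<alpha> > 0" and "n \<ge> 1" and "1 \<le> s" and "s \<le> d"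
    and "prob_space \<nu>" and "distr \<nu> borel uminus = \<nu>"
    and "prob_space.variance \<nu> (\<lambda>x. x) = 1"
    and "c > 0" and "strongly_log_concave c \<nu>"
    and "C1 = 2 * cdf std_normal_distribution (2 * sqrt c) - 1"
  shows "C1 > 0 \<and>
    (a > 2 * \<sigma> \<longrightarrow>
      (\<forall>\<tau>. 0 \<le> \<tau> \<and> C1 - \<tau> > 0 \<longrightarrow>
        (\<forall>\<theta> \<in> sparse_nonneg d s a.
          (\<integral>Z. 1 / real s * hamming d (selector n \<tau> Z) (pattern \<theta>) \<partial>private_sample \<alpha> d n \<sigma> \<nu> \<theta>)
            \<le> (real d - real (card (supp d \<theta>))) / real s
                * exp (- (real n * \<tau>\<^sup>2 / (2 * (B_const \<alpha> d)\<^sup>2)))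
              + real (card (supp d \<theta>)) / real s
                * exp (- (real n * (C1 - \<tau>)\<^sup>2 / (2 * (B_const \<alpha> d)\<^sup>2)))))) \<and>
    (a \<ge> 2 * \<sigma> \<longrightarrow>
      (SUP \<theta> \<in> sparse_nonneg d s a.
         ereal (\<integral>Z. 1 / real s * hamming d (selector n (C1 / 2) Z) (pattern \<theta>)
                  \<partial>private_sample \<alpha> d n \<sigma> \<nu> \<theta>))
        \<le> ereal (real d / real s
             * exp (- (C1\<^sup>2 * real n * (exp \<alpha> - 1)\<^sup>2 / (8 * (exp \<alpha> + 1)\<^sup>2 * (K_const d)\<^sup>2)))))"
proof -
  let ?e = "\<lambda>t. exp (- (real n * t\<^sup>2 / (2 * (B_const \<alpha> d)\<^sup>2)))"
  have sets: "sets \<nu> = sets borel"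
    using assms(10) by (auto simp: strongly_log_concave_def)
  interpret privacy_model \<alpha> \<sigma> d \<nu>
    by (rule privacy_model.intro) fact+
  have atom: "measure \<nu> {0} = 0"
    using assms(10) by (rule strongly_log_concave_atomless)
  have C1: "C1 = measure std_normal_distribution {- (2 * sqrt c)..2 * sqrt c}"
    using assms(9) by (simp add: assms(11) cdf_std_normal_symmetric)
  have pos: "C1 > 0"
    unfolding C1 using assms(9) by (intro measure_std_normal_interval_pos) simp
  \<comment> \<open>The bound is established already for a \<ge> 2 \<sigma>, so that it yields both
    claims.\<close>
  have risk: "(\<integral>Z. 1 / real s * hamming d (selector n \<tau> Z) (pattern \<theta>) \<partial>private_sample \<alpha> d n \<sigma> \<nu> \<theta>)
      \<le> (real d - real (card (supp d \<theta>))) / real s * ?e \<tau>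
        + real (card (supp d \<theta>)) / real s * ?e (C1 - \<tau>)"
    if a: "a \<ge> 2 * \<sigma>" and \<tau>: "0 \<le> \<tau>" "C1 - \<tau> > 0" and \<theta>: "\<theta> \<in> sparse_nonneg d s a" for \<tau> \<theta>
  proof -
    have "2 \<le> a / \<sigma>" using a assms(1) by (simp add: field_simps)
    interpret N: prob_space \<nu> by fact
    \<comment> \<open>Concentration is applied at \<open>t = 2\<close>, the least value that
      \<open>a / \<sigma>\<close> can take.\<close>
    have "C1 \<le> measure \<nu> {- 2..2}"
      unfolding C1 by (rule strongly_log_concave_concentration) fact+
    also have "\<dots> \<le> measure \<nu> {- (a / \<sigma>)..a / \<sigma>}"
      using \<open>2 \<le> a / \<sigma>\<close> by (intro N.finite_measure_mono) (auto simp: sets_noise)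
    finally have C: "C1 \<le> measure \<nu> {- (a / \<sigma>)..a / \<sigma>}" .
    have "a > 0" "\<tau> < C1" using a \<tau> assms(1) by auto
    from selector_risk_bound[OF assms(7,3) this(1) atom \<tau>(1) this(2) C \<theta>]
    have "1 / real s * (\<integral>Z. hamming d (selector n \<tau> Z) (pattern \<theta>) \<partial>private_sample \<alpha> d n \<sigma> \<nu> \<theta>)
        \<le> 1 / real s * ((real d - real (card (supp d \<theta>))) * ?e \<tau>
          + real (card (supp d \<theta>)) * ?e (C1 - \<tau>))"
      by (intro mult_left_mono) auto
    then show ?thesis by (simp add: add_divide_distrib)
  qed
  have "(SUP \<theta> \<in> sparse_nonneg d s a.
         ereal (\<integral>Z. 1 / real s * hamming d (selector n (C1 / 2) Z) (pattern \<theta>)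
                  \<partial>private_sample \<alpha> d n \<sigma> \<nu> \<theta>))
        \<le> ereal (real d / real s
             * exp (- (C1\<^sup>2 * real n * (exp \<alpha> - 1)\<^sup>2 / (8 * (exp \<alpha> + 1)\<^sup>2 * (K_const d)\<^sup>2))))"
    if "a \<ge> 2 * \<sigma>"
  proof (rule SUP_least)
    fix \<theta> assume \<theta>: "\<theta> \<in> sparse_nonneg d s a"
    \<comment> \<open>With \<tau> = C1/2 the two exponentials coincide, and their weights add up to
      d/s whatever the size of the support.\<close>
    have half: "C1 - C1 / 2 = C1 / 2" by simp
    have "real n * (C1 / 2)\<^sup>2 / (2 * (B_const \<alpha> d)\<^sup>2)
        = C1\<^sup>2 * real n * (exp \<alpha> - 1)\<^sup>2 / (8 * (exp \<alpha> + 1)\<^sup>2 * (K_const d)\<^sup>2)"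
      by (simp add: B_const_def power_divide power_mult_distrib mult_ac)
    then have e: "?e (C1 / 2)
        = exp (- (C1\<^sup>2 * real n * (exp \<alpha> - 1)\<^sup>2 / (8 * (exp \<alpha> + 1)\<^sup>2 * (K_const d)\<^sup>2)))"
      by (rule arg_cong)
    have "(real d - real (card (supp d \<theta>))) / real s * x + real (card (supp d \<theta>)) / real s * x
        = real d / real s * x" for x
      by (simp add: diff_divide_distrib left_diff_distrib)
    with risk[OF that _ _ \<theta>, of "C1 / 2", unfolded half e] pos
    show "ereal (\<integral>Z. 1 / real s * hamming d (selector n (C1 / 2) Z) (pattern \<theta>)
          \<partial>private_sample \<alpha> d n \<sigma> \<nu> \<theta>)
        \<le> ereal (real d / real s
             * exp (- (C1\<^sup>2 * real n * (exp \<alpha> - 1)\<^sup>2 / (8 * (exp \<alpha> + 1)\<^sup>2 * (K_const d)\<^sup>2))))"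
      by (simp only: ereal_less_eq)
  qed
  then show ?thesis
    using pos risk[OF less_imp_le] by (intro conjI impI allI ballI) (blast | fast)+
qed

end
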